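(* Let $f:X\to X$ be a topologically $GH$-stable homeomorphism of a compact metric space $X$. If $f$ admits an invariant Borel probability measure with full support, then \[ \overline{\mathrm{Per}(f)}=X . \]
   Context: $\mathrm{Per}(f)$ is the set of periodic points of $f$, i.e. points $x$ with $f^m(x)=x$ for some integer $m\ge1$. A Borel probability measure $\mu$ on $X$ is invariant under $f$ if $\mu(f^{-1}(E))=\mu(E)$ for every Borel set $E\subset X$. Its support is $\mathrm{supp}(\mu)=\{x\in X:\mu(U)>0\text{ for every open neighborhood }U\text{ of }x\}$, and $\mu$ has full support if $\mathrm{supp}(\mu)=X$. Hausdorff distance: for nonempty subsets $A,B$ of a metric space $(X,d)$, $d_H(A,B)=\max\{\sup_{a\in A}\inf_{b\in B}d(a,b),\ \sup_{b\in B}\inf_{a\in A}d(a,b)\}$. $\Delta$-isometry: for compact metric spaces $(X,d^X)$, $(Y,d^Y)$ and $\Delta>0$, a map (not necessarily continuous) $i:X\to Y$ is a $\Delta$-isometry if $\max\{d_H(i(X),Y),\ \sup_{x,x'\in X}|d^Y(i(x),i(x'))-d^X(x,x')|\}<\Delta$. Uniform distance: for (not necessarily continuous) maps $u,v:Z\to W$ between metric spaces, $d_{C^0}(u,v)=\sup_{z\in Z}d^W(u(z),v(z))$. $C^0$-Gromov--Hausdorff distance: for continuous maps $f:X\to X$ and $g:Y\to Y$ of compact metric spaces, $d_{GH^0}(f,g)$ is the infimum of all $\Delta>0$ for which there exist $\Delta$-isometries $i:X\to Y$ and $j:Y\to X$ such that $d_{C^0}(g\circ i,i\circ f)<\Delta$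 and $d_{C^0}(j\circ g,f\circ j)<\Delta$. Topological $GH$-stability: a homeomorphism $f:X\to X$ of a compact metric space is topologically $GH$-stable if for every $\varepsilon>0$ there exists $\eta>0$ such that for every homeomorphism $g:Y\to Y$ of a compact metric space with $d_{GH^0}(f,g)<\eta$ there exists a continuous $\varepsilon$-isometry $h:Y\to X$ with $f\circ h=h\circ g$. *)

theory Defs
  imports "HOL-Probability.Probability"
begin

text \<open>
  Spaces are abstract metrics \<open>X :: 'a metric\<close> with carrier \<^term>\<open>mspace X\<close>; maps are total
  functions of which only the restriction to the carrier matters. Distances are valued in
  \<^typ>\<open>ennreal\<close>, so that suprema and infima are the true ones, with \<open>inf {} = \<infinity>\<close>.
\<close>

definition hausdorff_dist :: "'a metric \<Rightarrow> 'a set \<Rightarrow> 'a set \<Rightarrow> ennreal" where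
  "hausdorff_dist X A B =
     max (SUP a\<in>A. INF b\<in>B. ennreal (mdist X a b)) (SUP b\<in>B. INF a\<in>A. ennreal (mdist X a b))"

definition GH_isometry :: "real \<Rightarrow> 'a metric \<Rightarrow> 'b metric \<Rightarrow> ('a \<Rightarrow> 'b) \<Rightarrow> bool" where
  "GH_isometry \<Delta> X Y i \<longleftrightarrow>
     i \<in> mspace X \<rightarrow> mspace Y \<and>
     max (hausdorff_dist Y (i ` mspace X) (mspace Y))
         (SUP x\<in>mspace X. SUP x'\<in>mspace X. ennreal \<bar>mdist Y (i x) (i x') - mdist X x x'\<bar>)
       < ennreal \<Delta>"

definition C0_dist :: "'a metric \<Rightarrow> 'b metric \<Rightarrow> ('a \<Rightarrow> 'b) \<Rightarrow> ('a \<Rightarrow> 'b) \<Rightarrow> ennreal" where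
  "C0_dist Z W u v = (SUP z\<in>mspace Z. ennreal (mdist W (u z) (v z)))"

definition GH0_dist :: "'a metric \<Rightarrow> ('a \<Rightarrow> 'a) \<Rightarrow> 'b metric \<Rightarrow> ('b \<Rightarrow> 'b) \<Rightarrow> ennreal" where
  "GH0_dist X f Y g =
     Inf {ennreal \<Delta> |\<Delta>. 0 < \<Delta> \<and>
       (\<exists>i j. GH_isometry \<Delta> X Y i \<and> GH_isometry \<Delta> Y X j \<and>
              C0_dist X Y (g \<circ> i) (i \<circ> f) < ennreal \<Delta> \<and>
              C0_dist Y X (j \<circ> g) (f \<circ> j) < ennreal \<Delta>)}"

definition GH_shadowed ::
    "real \<Rightarrow> real \<Rightarrow> 'a metric \<Rightarrow> ('a \<Rightarrow> 'a) \<Rightarrow> 'b metric \<Rightarrow> ('b \<Rightarrow> 'b) \<Rightarrow> bool" where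
  "GH_shadowed \<epsilon> \<eta> X f Y g \<longleftrightarrow>
     (compact_space (mtopology_of Y) \<and>
      homeomorphic_map (mtopology_of Y) (mtopology_of Y) g \<and>
      GH0_dist X f Y g < ennreal \<eta> \<longrightarrow>
      (\<exists>h. continuous_map (mtopology_of Y) (mtopology_of X) h \<and>
           GH_isometry \<epsilon> Y X h \<and>
           (\<forall>y\<in>mspace Y. f (h y) = h (g y))))"

text \<open>
  HOL cannot quantify over all types inside a definition. A compact metric space has at most
  continuum many points, so up to isometry it is some \<open>Y :: real metric\<close>: here \<open>real\<close> only
  supplies names for the points, while the carrier and the metric of \<open>Y\<close> are arbitrary and
  unrelated to the usual distance on the reals. Lemma \<open>top_GH_stable_any_type\<close> below shows that
  quantifying over these \<open>Y\<close> covers the compact metric spaces over every type.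
\<close>

definition top_GH_stable :: "'a metric \<Rightarrow> ('a \<Rightarrow> 'a) \<Rightarrow> bool" where
  "top_GH_stable X f \<longleftrightarrow>
     (\<forall>\<epsilon>>0. \<exists>\<eta>>0. \<forall>(Y :: real metric) g. GH_shadowed \<epsilon> \<eta> X f Y g)"

definition Per :: "'a metric \<Rightarrow> ('a \<Rightarrow> 'a) \<Rightarrow> 'a set" where
  "Per X f = {x \<in> mspace X. \<exists>m\<ge>1. (f ^^ m) x = x}"

definition borel_prob_on :: "'a metric \<Rightarrow> 'a measure \<Rightarrow> bool" where
  "borel_prob_on X \<mu> \<longleftrightarrow>
     prob_space \<mu> \<and> space \<mu> = mspace X \<and>
     sets \<mu> = sigma_sets (mspace X) {U. openin (mtopology_of X) U}"

definition invariant_measure :: "('a \<Rightarrow> 'a) \<Rightarrow> 'a measure \<Rightarrow> bool" where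
  "invariant_measure f \<mu> \<longleftrightarrow> (\<forall>E\<in>sets \<mu>. emeasure \<mu> (f -` E \<inter> space \<mu>) = emeasure \<mu> E)"

definition supp_measure :: "'a metric \<Rightarrow> 'a measure \<Rightarrow> 'a set" where
  "supp_measure X \<mu> = {x \<in> mspace X. \<forall>U. openin (mtopology_of X) U \<and> x \<in> U \<longrightarrow> emeasure \<mu> U > 0}"


subsection \<open>Independence of the type of the target space\<close>

lemma compact_metric_lepoll_real:
  fixes Y :: "'b metric"
  assumes "compact_space (mtopology_of Y)"
  shows "\<exists>\<phi> :: 'b \<Rightarrow> real. inj_on \<phi> (mspace Y)"
proof -
  interpret Y: Metric_space "mspace Y" "mdist Y" by simp
  have "Y.mtotally_bounded (mspace Y)"
    using assms Y.compact_space_eq_mcomplete_mtotally_bounded by (simp add: mtopology_of_def)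
  then have "\<forall>n. \<exists>K. finite K \<and> K \<subseteq> mspace Y \<and> mspace Y \<subseteq> (\<Union>x\<in>K. Y.mball x (1 / Suc n))"
    unfolding Y.mtotally_bounded_def by simp
  then obtain K where K: "\<And>n. finite (K n)" "\<And>n. K n \<subseteq> mspace Y"
      "\<And>n. mspace Y \<subseteq> (\<Union>x\<in>K n. Y.mball x (1 / Suc n))"
    by metis
  define D where "D = (\<Union>n. K n)"
  have "countable D" unfolding D_def using K(1) by (auto intro: countable_finite)
  define S where "S y = {(e, n). e \<in> D \<and> y \<in> Y.mball e (1 / Suc n)}" for y
  have "inj_on S (mspace Y)"
  proof (rule inj_onI, rule ccontr)
    fix x y assume xy: "x \<in> mspace Y" "y \<in> mspace Y" "S x = S y" "x \<noteq> y"
    then have "mdist Y x y / 2 > 0" by (simp add: Y.mdist_pos_eq)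
    then obtain n where n: "1 / Suc n < mdist Y x y / 2"
      using nat_approx_posE by (metis of_nat_Suc)
    obtain e where e: "e \<in> K n" "x \<in> Y.mball e (1 / Suc n)" using K(3) xy(1) by blast
    then have "(e, n) \<in> S x" by (auto simp: S_def D_def)
    then have "y \<in> Y.mball e (1 / Suc n)" using xy(3) by (auto simp: S_def)
    with e have "mdist Y e x < 1 / Suc n" "mdist Y e y < 1 / Suc n" "e \<in> mspace Y" by auto
    then show False
      using n Y.triangle[of x e y] Y.commute[of x e] xy by simp
  qed
  moreover have "countable (D \<times> (UNIV :: nat set))" using \<open>countable D\<close> by auto
  then obtain c :: "'b \<times> nat \<Rightarrow> nat" where c: "inj_on c (D \<times> UNIV)" by (auto simp: countable_def)
  have "S ` mspace Y \<subseteq> Pow (D \<times> UNIV)" by (auto simp: S_def)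
  then have "inj_on ((`) c) (S ` mspace Y)"
    using inj_on_image_Pow[OF c] inj_on_subset by blast
  moreover obtain r :: "nat set \<Rightarrow> real" where r: "inj r"
    using nat_sets_eqpoll_reals by (auto simp: eqpoll_def bij_betw_def)
  ultimately have "inj_on (r \<circ> ((`) c \<circ> S)) (mspace Y)"
    by (intro comp_inj_on) (auto intro: inj_on_subset simp: image_comp)
  then show ?thesis by blast
qed

locale metric_copy =
  fixes Y :: "'b metric" and Z :: "'c metric" and \<phi> :: "'b \<Rightarrow> 'c" and \<psi> :: "'c \<Rightarrow> 'b"
  assumes mspace_Z: "mspace Z = \<phi> ` mspace Y"
    and inv: "\<And>y. y \<in> mspace Y \<Longrightarrow> \<psi> (\<phi> y) = y"
    and iso: "\<And>x y. x \<in> mspace Y \<Longrightarrow> y \<in> mspace Y \<Longrightarrow> mdist Z (\<phi> x) (\<phi> y) = mdist Y x y"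
begin

lemma homeo: "homeomorphic_maps (mtopology_of Y) (mtopology_of Z) \<phi> \<psi>"
proof -
  interpret Metric_space12 "mspace Y" "mdist Y" "mspace Z" "mdist Z"
    by (simp add: Metric_space12_def)
  have "embedding_map (mtopology_of Y) (mtopology_of Z) \<phi>"
    unfolding mtopology_of_def
    by (rule isometry_imp_embedding_map) (auto simp: mspace_Z iso)
  then have h: "homeomorphic_map (mtopology_of Y) (mtopology_of Z) \<phi>"
    unfolding embedding_map_def topspace_mtopology_of mspace_Z[symmetric]
    by (metis subtopology_topspace topspace_mtopology_of)
  then obtain \<psi>' where *: "homeomorphic_maps (mtopology_of Y) (mtopology_of Z) \<phi> \<psi>'"
    using homeomorphic_map_maps by blast
  then show ?thesis
    by (rule homeomorphic_maps_eq) (use * inv in \<open>auto simp: mspace_Z homeomorphic_maps_def\<close>)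
qed

lemma hausdorff_dist_copy:
  "A \<subseteq> mspace Y \<Longrightarrow> B \<subseteq> mspace Y \<Longrightarrow> hausdorff_dist Z (\<phi> ` A) (\<phi> ` B) = hausdorff_dist Y A B"
  unfolding hausdorff_dist_def image_image
  by (intro arg_cong2[where f = max] SUP_cong INF_cong refl arg_cong[where f = ennreal])
     (auto intro!: iso)

lemma GH_isometry_into:
  assumes "GH_isometry \<Delta> X Y i" shows "GH_isometry \<Delta> X Z (\<phi> \<circ> i)"
proof -
  have i: "i x \<in> mspace Y" if "x \<in> mspace X" for x using assms that by (auto simp: GH_isometry_def)
  have "hausdorff_dist Z ((\<phi> \<circ> i) ` mspace X) (mspace Z) = hausdorff_dist Y (i ` mspace X) (mspace Y)"
    using hausdorff_dist_copy[of "i ` mspace X" "mspace Y"] i by (auto simp: mspace_Z image_comp)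
  moreover have "(SUP x\<in>mspace X. SUP x'\<in>mspace X. ennreal \<bar>mdist Z ((\<phi> \<circ> i) x) ((\<phi> \<circ> i) x') - mdist X x x'\<bar>)
     = (SUP x\<in>mspace X. SUP x'\<in>mspace X. ennreal \<bar>mdist Y (i x) (i x') - mdist X x x'\<bar>)"
    by (intro SUP_cong refl) (simp add: iso i)
  ultimately show ?thesis using assms i by (auto simp: GH_isometry_def mspace_Z)
qed

lemma GH_isometry_from:
  "GH_isometry \<Delta> Z X j \<longleftrightarrow> GH_isometry \<Delta> Y X (j \<circ> \<phi>)"
proof -
  have "(SUP x\<in>mspace Z. SUP x'\<in>mspace Z. ennreal \<bar>mdist X (j x) (j x') - mdist Z x x'\<bar>)
     = (SUP x\<in>mspace Y. SUP x'\<in>mspace Y. ennreal \<bar>mdist X ((j \<circ> \<phi>) x) ((j \<circ> \<phi>) x') - mdist Y x x'\<bar>)"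
    unfolding mspace_Z image_image by (intro SUP_cong refl) (simp add: iso)
  moreover have "j ` mspace Z = (j \<circ> \<phi>) ` mspace Y" by (simp add: mspace_Z image_comp)
  moreover have "j \<in> mspace Z \<rightarrow> mspace X \<longleftrightarrow> j \<circ> \<phi> \<in> mspace Y \<rightarrow> mspace X" by (auto simp: mspace_Z)
  ultimately show ?thesis unfolding GH_isometry_def by simp
qed

lemma GH0_dist_copy:
  assumes f: "f \<in> mspace X \<rightarrow> mspace X" and g: "g \<in> mspace Y \<rightarrow> mspace Y"
  shows "GH0_dist X f Z (\<phi> \<circ> g \<circ> \<psi>) \<le> GH0_dist X f Y g"
  unfolding GH0_dist_def
proof (rule Inf_superset_mono, clarify)
  fix \<Delta> :: real and i j assume "0 < \<Delta>" and i: "GH_isometry \<Delta> X Y i" and j: "GH_isometry \<Delta> Y X j"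
    and ci: "C0_dist X Y (g \<circ> i) (i \<circ> f) < ennreal \<Delta>"
    and cj: "C0_dist Y X (j \<circ> g) (f \<circ> j) < ennreal \<Delta>"
  have iY: "i x \<in> mspace Y" if "x \<in> mspace X" for x using i that by (auto simp: GH_isometry_def)
  let ?i = "\<phi> \<circ> i" and ?j = "j \<circ> \<psi>" and ?g = "\<phi> \<circ> g \<circ> \<psi>"
  have "GH_isometry \<Delta> Y X (?j \<circ> \<phi>) \<longleftrightarrow> GH_isometry \<Delta> Y X j"
    unfolding GH_isometry_def hausdorff_dist_def
    by (simp add: inv image_image cong: SUP_cong_simp INF_cong_simp Pi_cong)
  then have "GH_isometry \<Delta> Z X ?j" using j GH_isometry_from by blast
  moreover have "C0_dist X Z (?g \<circ> ?i) (?i \<circ> f) = C0_dist X Y (g \<circ> i) (i \<circ> f)"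
    unfolding C0_dist_def using f g iY
    by (intro SUP_cong refl arg_cong[where f = ennreal]) (auto simp: inv intro!: iso)
  moreover have "C0_dist Z X (?j \<circ> ?g) (f \<circ> ?j) = C0_dist Y X (j \<circ> g) (f \<circ> j)"
    unfolding C0_dist_def mspace_Z image_image using g
    by (intro SUP_cong refl arg_cong[where f = ennreal]) (auto simp: inv Pi_iff)
  ultimately show "\<exists>\<Delta>'. ennreal \<Delta> = ennreal \<Delta>' \<and> 0 < \<Delta>' \<and>
     (\<exists>i j. GH_isometry \<Delta>' X Z i \<and> GH_isometry \<Delta>' Z X j \<and>
        C0_dist X Z (?g \<circ> i) (i \<circ> f) < ennreal \<Delta>' \<and> C0_dist Z X (j \<circ> ?g) (f \<circ> j) < ennreal \<Delta>')"
    using \<open>0 < \<Delta>\<close> GH_isometry_into[OF i] ci cj by metis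
qed

lemma GH_shadowed_copy:
  assumes f: "f \<in> mspace X \<rightarrow> mspace X" and sh: "GH_shadowed \<epsilon> \<eta> X f Z (\<phi> \<circ> g \<circ> \<psi>)"
  shows "GH_shadowed \<epsilon> \<eta> X f Y g"
  unfolding GH_shadowed_def
proof (intro impI, elim conjE)
  assume Y: "compact_space (mtopology_of Y)" and hg: "homeomorphic_map (mtopology_of Y) (mtopology_of Y) g"
    and d: "GH0_dist X f Y g < ennreal \<eta>"
  have gY: "g y \<in> mspace Y" if "y \<in> mspace Y" for y
    using homeomorphic_imp_surjective_map[OF hg] that by auto
  have h\<phi>: "homeomorphic_map (mtopology_of Y) (mtopology_of Z) \<phi>"
    and h\<psi>: "homeomorphic_map (mtopology_of Z) (mtopology_of Y) \<psi>"
    using homeo homeomorphic_maps_map by blast+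
  have "compact_space (mtopology_of Z)"
    using Y homeomorphic_compact_space homeo homeomorphic_space_def by blast
  moreover have "homeomorphic_map (mtopology_of Z) (mtopology_of Z) (\<phi> \<circ> g \<circ> \<psi>)"
    using homeomorphic_map_compose[OF h\<psi> homeomorphic_map_compose[OF hg h\<phi>]]
    by (simp add: comp_assoc)
  moreover have "GH0_dist X f Z (\<phi> \<circ> g \<circ> \<psi>) < ennreal \<eta>"
    using GH0_dist_copy[OF f, of g] gY d by (meson Pi_I le_less_trans)
  ultimately obtain h where h: "continuous_map (mtopology_of Z) (mtopology_of X) h"
      "GH_isometry \<epsilon> Z X h" "\<forall>z\<in>mspace Z. f (h z) = h ((\<phi> \<circ> g \<circ> \<psi>) z)"
    using sh unfolding GH_shadowed_def by blast
  have "continuous_map (mtopology_of Y) (mtopology_of X) (h \<circ> \<phi>)"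
    using continuous_map_compose[OF homeomorphic_imp_continuous_map[OF h\<phi>] h(1)] .
  moreover have "GH_isometry \<epsilon> Y X (h \<circ> \<phi>)" using h(2) GH_isometry_from by blast
  moreover have "\<forall>y\<in>mspace Y. f ((h \<circ> \<phi>) y) = (h \<circ> \<phi>) (g y)"
    using h(3) by (simp add: mspace_Z inv)
  ultimately show "\<exists>h. continuous_map (mtopology_of Y) (mtopology_of X) h \<and>
      GH_isometry \<epsilon> Y X h \<and> (\<forall>y\<in>mspace Y. f (h y) = h (g y))"
    by blast
qed

end

lemma top_GH_stable_any_type:
  fixes X :: "'a metric"
  assumes "top_GH_stable X f" and f: "f \<in> mspace X \<rightarrow> mspace X"
  shows "\<forall>\<epsilon>>0. \<exists>\<eta>>0. \<forall>(Y :: 'b metric) g. GH_shadowed \<epsilon> \<eta> X f Y g"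
proof (intro allI impI)
  fix \<epsilon> :: real assume "\<epsilon> > 0"
  then obtain \<eta> where "\<eta> > 0" and \<eta>: "\<And>(Z :: real metric) g. GH_shadowed \<epsilon> \<eta> X f Z g"
    using assms(1) unfolding top_GH_stable_def by blast
  have "GH_shadowed \<epsilon> \<eta> X f Y g" for Y :: "'b metric" and g
  proof (cases "compact_space (mtopology_of Y)")
    case True
    then obtain \<phi> :: "'b \<Rightarrow> real" where \<phi>: "inj_on \<phi> (mspace Y)"
      using compact_metric_lepoll_real by blast
    define \<psi> where "\<psi> = the_inv_into (mspace Y) \<phi>"
    have \<psi>: "\<psi> (\<phi> y) = y" if "y \<in> mspace Y" for y
      using that \<phi> by (simp add: \<psi>_def the_inv_into_f_f)
    define Z where "Z = metric (\<phi> ` mspace Y, \<lambda>a b. mdist Y (\<psi> a) (\<psi> b))"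
    have Z: "Metric_space (\<phi> ` mspace Y) (\<lambda>a b. mdist Y (\<psi> a) (\<psi> b))"
      by unfold_locales (auto simp: \<psi> mdist_commute mdist_triangle)
    interpret metric_copy Y Z \<phi> \<psi>
      by unfold_locales
         (auto simp: Z_def \<psi> Metric_space.mspace_metric[OF Z] Metric_space.mdist_metric[OF Z])
    show ?thesis using GH_shadowed_copy[OF f \<eta>] .
  qed (simp add: GH_shadowed_def)
  with \<open>\<eta> > 0\<close> show "\<exists>\<eta>>0. \<forall>(Y :: 'b metric) g. GH_shadowed \<epsilon> \<eta> X f Y g" by blast
qed

end

theory Submission
  imports Defs
begin

text \<open>
  An invariant measure of full support makes every open set return to itself, so every point is
  approximated by points \<open>p\<close> with \<open>f\<^sup>n p\<close> close to \<open>p\<close>. Take finitely many such orbit segments that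
  are dense up to a small error and close each of them up to a cycle: their disjoint union is a
  finite metric space with a permutation \<open>g\<close> that is \<open>GH\<^sup>0\<close>-close to \<open>f\<close>. Stability yields an
  \<open>\<epsilon>\<close>-isometry semiconjugating \<open>g\<close> to \<open>f\<close>; its image is \<open>\<epsilon>\<close>-dense and consists of periodic
  points of \<open>f\<close>.
\<close>

section \<open>Poincare recurrence\<close>

text \<open>If no point of \<open>U\<close> returned, the preimages of \<open>U\<close> under the
  iterates of \<open>T\<close> would be infinitely many pairwise disjoint sets of the same positive
  measure, which a finite measure excludes.\<close>

lemma (in finite_measure) positive_measure_return:
  assumes T: "T \<in> measurable M M"
    and inv: "\<And>E. E \<in> sets M \<Longrightarrow> emeasure M (T -` E \<inter> space M) = emeasure M E"
    and U: "U \<in> sets M" "emeasure M U > 0"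
  shows "\<exists>x\<in>U. \<exists>n\<ge>1. (T ^^ n) x \<in> U"
proof (rule ccontr)
  assume no: "\<not> ?thesis"
  define A where "A n = (T ^^ n) -` U \<inter> space M" for n
  have TA: "A (Suc n) = T -` A n \<inter> space M" for n
    using measurable_space[OF T] by (auto simp: A_def funpow_Suc_right simp del: funpow.simps)
  have A: "A n \<in> sets M \<and> emeasure M (A n) = emeasure M U" for n
  proof (induction n)
    case 0
    have "A 0 = U" using sets.sets_into_space[OF U(1)] by (auto simp: A_def)
    then show ?case using U by simp
  next
    case (Suc n)
    then show ?case using measurable_sets[OF T] inv by (simp add: TA)
  qed
  \<comment> \<open>For a common point \<open>x\<close>, the iterate \<open>(T ^^ m) x\<close> lies
    in \<open>U\<close> and returns to \<open>U\<close> after \<open>n - m\<close> steps.\<close>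
  have disj: "A m \<inter> A n = {}" if "m < n" for m n
  proof (rule ccontr)
    assume "A m \<inter> A n \<noteq> {}"
    then obtain x where x: "(T ^^ m) x \<in> U" "(T ^^ n) x \<in> U" by (auto simp: A_def)
    have "(T ^^ (n - m)) ((T ^^ m) x) = (T ^^ n) x"
      using that funpow_add[of "n - m" m T] by simp
    with x that have "(T ^^ m) x \<in> U \<and> n - m \<ge> 1 \<and> (T ^^ (n - m)) ((T ^^ m) x) \<in> U"
      by simp
    with no show False by blast
  qed
  have "disjoint_family A"
    unfolding disjoint_family_on_def using disj by (metis Int_commute nat_neq_iff)
  then have "(\<lambda>n. measure M (A n)) sums measure M (\<Union>n. A n)"
    using A by (intro finite_measure_UNION) auto
  moreover have "measure M (A n) = measure M U" for n using A by (simp add: measure_def)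
  ultimately have "summable (\<lambda>n::nat. measure M U)" by (simp add: sums_iff)
  then have "measure M U = 0" by (rule summable_const_iff[THEN iffD1])
  then show False using U by (simp add: emeasure_eq_measure)
qed

section \<open>Pointwise bounds for Hausdorff and Gromov-Hausdorff distances\<close>

lemma hausdorff_dist_le:
  assumes "\<And>a. a \<in> A \<Longrightarrow> \<exists>b\<in>B. mdist X a b \<le> r" "\<And>b. b \<in> B \<Longrightarrow> \<exists>a\<in>A. mdist X a b \<le> r"
  shows "hausdorff_dist X A B \<le> ennreal r"
  unfolding hausdorff_dist_def
  by (intro max.boundedI SUP_least) (use assms in \<open>blast intro: INF_lower2 ennreal_leI\<close>)+

lemma mdist_self: "x \<in> mspace m \<Longrightarrow> mdist m x x = 0"
  by simp

text \<open>Strict pointwise bounds survive a supremum only as weak ones, hence the slack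
  \<open>r < \<Delta>\<close>. Positivity of \<open>\<Delta>\<close> is a separate assumption
  because \<open>r\<close> may be negative over an empty carrier, where \<open>ennreal r\<close> is
  0.\<close>

lemma GH_isometryI:
  assumes i: "i \<in> mspace X \<rightarrow> mspace Y" and r: "r < \<Delta>" "0 < \<Delta>"
    and dense: "\<And>y. y \<in> mspace Y \<Longrightarrow> \<exists>x\<in>mspace X. mdist Y (i x) y \<le> r"
    and dist: "\<And>x x'. x \<in> mspace X \<Longrightarrow> x' \<in> mspace X \<Longrightarrow> \<bar>mdist Y (i x) (i x') - mdist X x x'\<bar> \<le> r"
  shows "GH_isometry \<Delta> X Y i"
proof -
  have "hausdorff_dist Y (i ` mspace X) (mspace Y) \<le> ennreal r"
  proof (rule hausdorff_dist_le)
    fix a assume "a \<in> i ` mspace X"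
    then obtain x where x: "x \<in> mspace X" "a = i x" by blast
    then have "a \<in> mspace Y" using i by auto
    \<comment> \<open>The distortion bound at the pair \<open>x\<close>, \<open>x\<close> forces
      \<open>0 \<le> r\<close>.\<close>
    moreover have "mdist Y a a \<le> r" using dist[OF x(1) x(1)] x \<open>a \<in> mspace Y\<close> by (simp add: mdist_self)
    ultimately show "\<exists>b\<in>mspace Y. mdist Y a b \<le> r" by blast
  qed (use dense in blast)
  moreover have "(SUP x\<in>mspace X. SUP x'\<in>mspace X. ennreal \<bar>mdist Y (i x) (i x') - mdist X x x'\<bar>)
    \<le> ennreal r"
    by (intro SUP_least ennreal_leI dist)
  moreover have "ennreal r < ennreal \<Delta>" using r by (simp add: ennreal_lessI)
  ultimately show ?thesis using i by (auto simp: GH_isometry_def intro: le_less_trans)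
qed

lemma GH_isometry_dense:
  assumes "GH_isometry \<Delta> X Y i" "y \<in> mspace Y"
  obtains x where "x \<in> mspace X" "mdist Y (i x) y < \<Delta>"
proof -
  have "(INF a\<in>i ` mspace X. ennreal (mdist Y a y)) \<le> hausdorff_dist Y (i ` mspace X) (mspace Y)"
    unfolding hausdorff_dist_def by (rule max.coboundedI2, rule SUP_upper) (rule assms)
  also have "\<dots> < ennreal \<Delta>" using assms(1) by (simp add: GH_isometry_def)
  finally obtain x where "x \<in> mspace X" "ennreal (mdist Y (i x) y) < ennreal \<Delta>"
    by (auto simp: INF_less_iff)
  then show ?thesis using that by (simp add: ennreal_less_iff)
qed

lemma GH0_dist_le:
  assumes "0 < \<Delta>" "r < \<Delta>" "GH_isometry \<Delta> X Y i" "GH_isometry \<Delta> Y X j"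
    and "\<And>x. x \<in> mspace X \<Longrightarrow> mdist Y (g (i x)) (i (f x)) \<le> r"
    and "\<And>y. y \<in> mspace Y \<Longrightarrow> mdist X (j (g y)) (f (j y)) \<le> r"
  shows "GH0_dist X f Y g \<le> ennreal \<Delta>"
proof -
  have "C0_dist X Y (g \<circ> i) (i \<circ> f) \<le> ennreal r" "C0_dist Y X (j \<circ> g) (f \<circ> j) \<le> ennreal r"
    unfolding C0_dist_def using assms(5,6) by (auto intro!: SUP_least ennreal_leI)
  moreover have "ennreal r < ennreal \<Delta>" using assms by (simp add: ennreal_lessI)
  ultimately show ?thesis
    unfolding GH0_dist_def using assms(1,3,4) by (blast intro: Inf_lower le_less_trans)
qed

section \<open>Pullback metrics\<close>

text \<open>
  The summand \<open>e\<close> separates points of \<open>Y\<close> with the same image under \<open>j\<close>, so that \<open>j\<close> need not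
  be injective.
\<close>

definition pullback_metric :: "'a metric \<Rightarrow> real \<Rightarrow> 'b set \<Rightarrow> ('b \<Rightarrow> 'a) \<Rightarrow> 'b metric" where
  "pullback_metric X e Y j = metric (Y, \<lambda>a b. if a = b then 0 else mdist X (j a) (j b) + e)"

context
  fixes X :: "'a metric" and e :: real and Y :: "'b set" and j :: "'b \<Rightarrow> 'a"
  assumes e: "e > 0" and j: "j \<in> Y \<rightarrow> mspace X"
begin

lemma Metric_space_pullback:
  "Metric_space Y (\<lambda>a b. if a = b then 0 else mdist X (j a) (j b) + e)"
proof
  fix a b c assume "a \<in> Y" "b \<in> Y" "c \<in> Y"
  then have "mdist X (j a) (j c) \<le> mdist X (j a) (j b) + mdist X (j b) (j c)"
    using j by (intro mdist_triangle) auto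
  then show "(if a = c then 0 else mdist X (j a) (j c) + e)
      \<le> (if a = b then 0 else mdist X (j a) (j b) + e) + (if b = c then 0 else mdist X (j b) (j c) + e)"
    using e by (auto simp: add_nonneg_nonneg)
next
  fix a b assume "a \<in> Y" "b \<in> Y"
  have "mdist X (j a) (j b) + e > 0" using e by (simp add: add_nonneg_pos)
  then show "(if a = b then 0 else mdist X (j a) (j b) + e) = 0 \<longleftrightarrow> a = b" by auto
qed (use e in \<open>auto simp: mdist_commute\<close>)

lemma mspace_pullback [simp]: "mspace (pullback_metric X e Y j) = Y"
  and mdist_pullback:
    "mdist (pullback_metric X e Y j) = (\<lambda>a b. if a = b then 0 else mdist X (j a) (j b) + e)"
  unfolding pullback_metric_def
  by (rule Metric_space.mspace_metric[OF Metric_space_pullback],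
      rule Metric_space.mdist_metric[OF Metric_space_pullback])

lemma mdist_pullback_bounds:
  assumes "a \<in> Y" "b \<in> Y"
  shows "mdist X (j a) (j b) \<le> mdist (pullback_metric X e Y j) a b"
    and "mdist (pullback_metric X e Y j) a b \<le> mdist X (j a) (j b) + e"
  using e j assms by (auto simp: mdist_pullback mdist_self Pi_iff)

text \<open>A choice function \<open>i\<close> picks for each \<open>x\<close> a point of
  \<open>Y\<close> whose \<open>j\<close>-image approximates \<open>x\<close>, so \<open>i\<close>
  is a right inverse of \<open>j\<close> up to \<open>e\<close>. The distortion is at most
  \<open>e\<close> for \<open>j\<close> and \<open>3 * e\<close> for \<open>i\<close>, and the
  conjugacy errors are at most \<open>4 * e\<close>; the factor 5 makes all these bounds strict. The
  second conjunct of \<open>dense\<close> is where continuity of \<open>f\<close> enters.\<close>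

lemma GH0_dist_pullback_le:
  assumes f: "f \<in> mspace X \<rightarrow> mspace X" and g: "g \<in> Y \<rightarrow> Y"
    and dense: "\<And>x. x \<in> mspace X \<Longrightarrow> \<exists>y\<in>Y. mdist X (j y) x \<le> e \<and> mdist X (f (j y)) (f x) \<le> e"
    and orbit: "\<And>y. y \<in> Y \<Longrightarrow> mdist X (j (g y)) (f (j y)) \<le> e"
  shows "GH0_dist X f (pullback_metric X e Y j) g \<le> ennreal (5 * e)"
proof -
  let ?Y = "pullback_metric X e Y j"
  obtain i where i: "\<And>x. x \<in> mspace X \<Longrightarrow> i x \<in> Y"
    and ji: "\<And>x. x \<in> mspace X \<Longrightarrow> mdist X (j (i x)) x \<le> e"
    and fji: "\<And>x. x \<in> mspace X \<Longrightarrow> mdist X (f (j (i x))) (f x) \<le> e"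
    using dense by metis
  have jX: "j y \<in> mspace X" if "y \<in> Y" for y using j that by auto
  have fX: "f x \<in> mspace X" if "x \<in> mspace X" for x using f that by auto
  have gY: "g y \<in> Y" if "y \<in> Y" for y using g that by auto
  have isoj: "GH_isometry (5 * e) ?Y X j"
  proof (rule GH_isometryI[where r = e])
    fix x assume "x \<in> mspace X"
    with dense show "\<exists>y\<in>mspace ?Y. mdist X (j y) x \<le> e" by auto
  next
    fix a b assume "a \<in> mspace ?Y" "b \<in> mspace ?Y"
    then show "\<bar>mdist X (j a) (j b) - mdist ?Y a b\<bar> \<le> e"
      using mdist_pullback_bounds[of a b] by auto
  qed (use e j in auto)
  have isoi: "GH_isometry (5 * e) X ?Y i"
  proof (rule GH_isometryI[where r = "3 * e"])
    fix y assume "y \<in> mspace ?Y"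
    then have y: "y \<in> Y" by simp
    \<comment> \<open>Here \<open>2 * e\<close> would do: \<open>e\<close> from the choice of
      \<open>i\<close> and \<open>e\<close> from the pullback metric. The distortion bound below
      fixes the common constant 3.\<close>
    have "mdist ?Y (i (j y)) y \<le> 3 * e"
      using mdist_pullback_bounds(2)[of "i (j y)" y] ji[of "j y"] i jX y e by fastforce
    then show "\<exists>x\<in>mspace X. mdist ?Y (i x) y \<le> 3 * e" using jX y by blast
  next
    fix a b assume ab: "a \<in> mspace X" "b \<in> mspace X"
    note in_carrier = ab i[OF ab(1)] i[OF ab(2)] jX[OF i[OF ab(1)]] jX[OF i[OF ab(2)]]
    have "mdist X (j (i a)) (j (i b)) \<le> mdist X (j (i a)) a + mdist X a b + mdist X (j (i b)) b"
      using in_carrier mdist_triangle[of "j (i a)" X a "j (i b)"] mdist_triangle[of a X b "j (i b)"]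
      by (simp add: mdist_commute)
    moreover
    have "mdist X a b \<le> mdist X (j (i a)) a + mdist X (j (i a)) (j (i b)) + mdist X (j (i b)) b"
      using in_carrier mdist_triangle[of a X "j (i a)" b] mdist_triangle[of "j (i a)" X "j (i b)" b]
      by (simp add: mdist_commute)
    ultimately show "\<bar>mdist ?Y (i a) (i b) - mdist X a b\<bar> \<le> 3 * e"
      using mdist_pullback_bounds[of "i a" "i b"] in_carrier ji[OF ab(1)] ji[OF ab(2)] by linarith
  qed (use e i in auto)
  show ?thesis
  proof (rule GH0_dist_le[OF _ _ isoi isoj, where r = "4 * e"])
    fix x assume x: "x \<in> mspace X"
    let ?a = "j (g (i x))" and ?b = "f (j (i x))" and ?c = "f x" and ?d = "j (i (f x))"
    have X: "?a \<in> mspace X" "?b \<in> mspace X" "?c \<in> mspace X" "?d \<in> mspace X"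
      using i jX fX gY x by auto
    \<comment> \<open>The three terms are the orbit error at \<open>i x\<close>, the effect under
      \<open>f\<close> of replacing \<open>x\<close> by \<open>j (i x)\<close>, and the error of
      \<open>i\<close> at \<open>f x\<close>. Passing to the pullback metric adds a fourth
      \<open>e\<close>.\<close>
    have "mdist X ?a ?d \<le> mdist X ?a ?b + mdist X ?b ?c + mdist X ?d ?c"
      using mdist_triangle[OF X(1,2,4)] mdist_triangle[OF X(2,3,4)] by (simp add: mdist_commute)
    also have "\<dots> \<le> e + e + e"
      by (intro add_mono orbit fji ji) (use i fX x in auto)
    finally show "mdist ?Y (g (i x)) (i (f x)) \<le> 4 * e"
      using mdist_pullback_bounds(2)[of "g (i x)" "i (f x)"] i fX gY x by fastforce
  next
    fix y assume "y \<in> mspace ?Y"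
    then show "mdist X (j (g y)) (f (j y)) \<le> 4 * e" using orbit[of y] e by simp
  qed (use e in auto)
qed

text \<open>A finite T1 space is discrete. This makes the approximating space compact and every
  permutation of it a homeomorphism.\<close>

lemma mtopology_of_finite_pullback:
  assumes "finite Y"
  shows "mtopology_of (pullback_metric X e Y j) = discrete_topology Y"
proof -
  interpret Metric_space Y "mdist (pullback_metric X e Y j)"
    unfolding mdist_pullback by (rule Metric_space_pullback)
  have "t1_space mtopology" by (simp add: Hausdorff_imp_t1_space Hausdorff_space_mtopology)
  then show ?thesis
    using assms finite_t1_space_imp_discrete_topology[of mtopology Y] by (simp add: mtopology_of_def)
qed

end

section \<open>Permutations of finite discrete spaces\<close>

lemma homeomorphic_map_discrete_bij:
  assumes "bij_betw g Y Y"
  shows "homeomorphic_map (discrete_topology Y) (discrete_topology Y) g"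
  using assms
  by (intro bijective_open_imp_homeomorphic_map)
     (auto simp: bij_betw_def open_map_def dest: bij_betwE)

text \<open>The point \<open>(x, t)\<close> with \<open>t < n x\<close> is the one at time \<open>t\<close> on a cycle of length \<open>n x\<close>.\<close>

definition rotate_cycles :: "('a \<Rightarrow> nat) \<Rightarrow> 'a \<times> nat \<Rightarrow> 'a \<times> nat" where
  "rotate_cycles n = (\<lambda>(x, t). (x, Suc t mod n x))"

lemma rotate_cycles_funpow:
  assumes "t < n x"
  shows "(rotate_cycles n ^^ k) (x, t) = (x, (t + k) mod n x)"
  using assms by (induction k) (simp_all add: rotate_cycles_def mod_Suc_eq)

text \<open>The \<open>n x\<close>-th iterate fixes \<open>(x, t)\<close>, so the iterate before it
  is a preimage of \<open>(x, t)\<close>. A surjective self-map of a finite set is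
  injective.\<close>

lemma bij_rotate_cycles:
  assumes "finite D"
  shows "bij_betw (rotate_cycles n) (SIGMA x:D. {..<n x}) (SIGMA x:D. {..<n x})" (is "bij_betw _ ?Y _")
proof -
  have sub: "rotate_cycles n ` ?Y \<subseteq> ?Y"
    by (auto simp: rotate_cycles_def intro!: mod_less_divisor)
  have "?Y \<subseteq> rotate_cycles n ` ?Y"
  proof clarify
    fix x t assume x: "x \<in> D" "t < n x"
    have "(rotate_cycles n ^^ n x) (x, t) = (x, t)" using x by (simp add: rotate_cycles_funpow)
    moreover obtain k where "n x = Suc k" using x by (cases "n x") auto
    ultimately have "rotate_cycles n (x, (t + k) mod n x) = (x, t)"
      using rotate_cycles_funpow[of t n x k] x by simp
    moreover have "(x, (t + k) mod n x) \<in> ?Y" using x by auto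
    ultimately show "(x, t) \<in> rotate_cycles n ` ?Y" by (metis imageI)
  qed
  moreover have "finite ?Y" using assms by auto
  ultimately show ?thesis using sub finite_surj_inj by (metis bij_betw_def subset_antisym)
qed

section \<open>Approximation by finite periodic systems\<close>

lemma dense_near_returns:
  assumes fc: "continuous_map (mtopology_of X) (mtopology_of X) f"
    and \<mu>: "borel_prob_on X \<mu>" and inv: "invariant_measure f \<mu>"
    and supp: "supp_measure X \<mu> = mspace X" and x: "x \<in> mspace X" and "e > 0"
  obtains y n where "y \<in> mspace X" "n \<ge> 1" "mdist X y x < e" "mdist X ((f ^^ n) y) y < e"
proof -
  interpret X: Metric_space "mspace X" "mdist X" by simp
  interpret prob_space \<mu> using \<mu> by (simp add: borel_prob_on_def)
  have sp: "space \<mu> = mspace X"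
    and sets: "sets \<mu> = sigma_sets (mspace X) {U. openin (mtopology_of X) U}"
    using \<mu> by (auto simp: borel_prob_on_def)
  have opn: "U \<in> sets \<mu>" if "openin (mtopology_of X) U" for U using that by (auto simp: sets)
  have T: "f \<in> measurable \<mu> \<mu>"
  proof (rule measurable_sigma_sets[OF sets])
    show "{U. openin (mtopology_of X) U} \<subseteq> Pow (mspace X)"
      using openin_subset by fastforce
    show "f \<in> space \<mu> \<rightarrow> mspace X" using fc by (auto simp: sp continuous_map_def)
    fix U assume "U \<in> {U. openin (mtopology_of X) U}"
    then have "openin (mtopology_of X) {x \<in> mspace X. f x \<in> U}"
      using openin_continuous_map_preimage[OF fc, of U] by simp
    moreover have "{x \<in> mspace X. f x \<in> U} = f -` U \<inter> space \<mu>" by (auto simp: sp)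
    ultimately show "f -` U \<inter> space \<mu> \<in> sets \<mu>" using opn by metis
  qed
  \<comment> \<open>With radius \<open>e / 2\<close>, a point of the ball and its return are less
    than \<open>e\<close> apart.\<close>
  let ?U = "X.mball x (e / 2)"
  have U: "openin (mtopology_of X) ?U" by (simp add: mtopology_of_def)
  moreover have "x \<in> ?U" using x \<open>e > 0\<close> by simp
  ultimately have "emeasure \<mu> ?U > 0" using supp x by (force simp: supp_measure_def)
  then obtain y n where y: "y \<in> ?U" "n \<ge> 1" "(f ^^ n) y \<in> ?U"
    using positive_measure_return[OF T _ opn[OF U]] inv by (auto simp: invariant_measure_def)
  have "mdist X ((f ^^ n) y) y \<le> mdist X x ((f ^^ n) y) + mdist X x y"
    using y X.triangle[of "(f ^^ n) y" x y] by (simp add: X.commute)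
  with y have "mdist X ((f ^^ n) y) y < e" by auto
  moreover have "mdist X y x < e" using y \<open>e > 0\<close> by (auto simp: X.commute)
  ultimately show ?thesis using that y by auto
qed

lemma periodic_approximation:
  fixes X :: "'a metric"
  assumes comp: "compact_space (mtopology_of X)"
    and fc: "continuous_map (mtopology_of X) (mtopology_of X) f"
    and \<mu>: "borel_prob_on X \<mu>" "invariant_measure f \<mu>" "supp_measure X \<mu> = mspace X" and "\<eta> > 0"
  obtains Y :: "('a \<times> nat) metric" and g where "compact_space (mtopology_of Y)"
    "homeomorphic_map (mtopology_of Y) (mtopology_of Y) g" "GH0_dist X f Y g < ennreal \<eta>"
    "Per Y g = mspace Y"
proof -
  interpret X: Metric_space "mspace X" "mdist X" by simp
  \<comment> \<open>The pullback estimate gives \<open>5 * e\<close>, which must stay strictly below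
    \<open>\<eta>\<close>.\<close>
  define e where "e = \<eta> / 6"
  have e: "e > 0" using \<open>\<eta> > 0\<close> by (simp add: e_def)
  have fX: "f x \<in> mspace X" if "x \<in> mspace X" for x
    using fc that by (auto simp: continuous_map_def)
  have fnX: "(f ^^ n) x \<in> mspace X" if "x \<in> mspace X" for x n
    using that fX by (induction n) auto
  have "uniformly_continuous_map X X f"
    using comp fc by (simp add: continuous_eq_uniformly_continuous_map)
  then obtain d where d: "d > 0"
    "\<And>x y. x \<in> mspace X \<Longrightarrow> y \<in> mspace X \<Longrightarrow> mdist X y x < d \<Longrightarrow> mdist X (f y) (f x) < e"
    using e unfolding uniformly_continuous_map_def by metis
  \<comment> \<open>A point of \<open>X\<close> is within \<open>r\<close> of the net, and a net
    point within \<open>r\<close> of its nearly returning point. The total \<open>2 * r\<close> must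
    respect both \<open>e\<close> and the modulus \<open>d\<close> of uniform continuity.\<close>
  define r where "r = min e d / 2"
  have r: "r > 0" "r < e" "2 * r \<le> e" "2 * r \<le> d" using e d by (auto simp: r_def)
  have "X.mtotally_bounded (mspace X)"
    using comp X.compact_space_eq_mcomplete_mtotally_bounded by (simp add: mtopology_of_def)
  then obtain K where K: "finite K" "K \<subseteq> mspace X" "mspace X \<subseteq> (\<Union>x\<in>K. X.mball x r)"
    using r(1) unfolding X.mtotally_bounded_def by metis
  have "\<forall>x\<in>K. \<exists>y n. y \<in> mspace X \<and> n \<ge> 1 \<and> mdist X y x < r \<and> mdist X ((f ^^ n) y) y < r"
    using dense_near_returns[OF fc \<mu> _ r(1)] K(2) by (metis subsetD)
  then obtain p n where p: "\<And>x. x \<in> K \<Longrightarrow> p x \<in> mspace X" "\<And>x. x \<in> K \<Longrightarrow> n x \<ge> (1::nat)"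
    "\<And>x. x \<in> K \<Longrightarrow> mdist X (p x) x < r" "\<And>x. x \<in> K \<Longrightarrow> mdist X ((f ^^ n x) (p x)) (p x) < r"
    by metis
  \<comment> \<open>Orbit segments may meet in \<open>X\<close>; tagging each time by its net point
    keeps the cycles disjoint, so that \<open>g\<close> is a permutation.\<close>
  define Y where "Y = (SIGMA x:K. {..<n x})"
  define j where "j = (\<lambda>(x, t). (f ^^ t) (p x))"
  define g where "g = rotate_cycles n"
  let ?Y = "pullback_metric X e Y j"
  have j: "j \<in> Y \<rightarrow> mspace X" using p(1) fnX by (auto simp: Y_def j_def)
  have "finite Y" using K(1) by (auto simp: Y_def)
  have g: "bij_betw g Y Y" unfolding g_def Y_def by (rule bij_rotate_cycles[OF K(1)])
  note disc = mtopology_of_finite_pullback[OF e j \<open>finite Y\<close>]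
  have Y: "mspace ?Y = Y" by (rule mspace_pullback[OF e j])
  show thesis
  proof (rule that[of ?Y g])
    show "compact_space (mtopology_of ?Y)"
      using \<open>finite Y\<close> by (simp add: disc compact_space_discrete_topology)
    show "homeomorphic_map (mtopology_of ?Y) (mtopology_of ?Y) g"
      unfolding disc by (rule homeomorphic_map_discrete_bij[OF g])
    have "GH0_dist X f ?Y g \<le> ennreal (5 * e)"
    proof (rule GH0_dist_pullback_le[OF e j])
      show "f \<in> mspace X \<rightarrow> mspace X" using fX by auto
      show "g \<in> Y \<rightarrow> Y" using g bij_betwE by blast
    next
      fix x assume x: "x \<in> mspace X"
      then obtain k where k: "k \<in> K" "mdist X k x < r" using K(3) by auto
      have "mdist X (p k) x \<le> mdist X (p k) k + mdist X k x"
        using X.triangle[of "p k" k x] p(1) k K(2) x by auto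
      then have *: "mdist X (p k) x < 2 * r" using p(3)[OF k(1)] k(2) by simp
      then have "mdist X (f (p k)) (f x) \<le> e"
        using d(2)[of x "p k"] r(4) p(1)[OF k(1)] x by fastforce
      \<comment> \<open>The starting points of the segments are already dense enough;
        \<open>n k \<ge> 1\<close> puts time 0 into the cycle.\<close>
      moreover have "(k, 0) \<in> Y" "j (k, 0) = p k" using p(2)[OF k(1)] k(1) by (auto simp: Y_def j_def)
      ultimately show "\<exists>y\<in>Y. mdist X (j y) x \<le> e \<and> mdist X (f (j y)) (f x) \<le> e"
        using * r(3) by (intro bexI[of _ "(k, 0)"]) auto
    next
      fix y assume "y \<in> Y"
      then obtain x t where y: "y = (x, t)" "x \<in> K" "t < n x" by (auto simp: Y_def)
      show "mdist X (j (g y)) (f (j y)) \<le> e"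
      \<comment> \<open>Only the last step of a cycle, which jumps back to \<open>p x\<close>, has
        an error, namely the return error. On all other steps \<open>j\<close> intertwines
        \<open>g\<close> and \<open>f\<close> exactly.\<close>
      proof (cases "Suc t = n x")
        case True
        then have "j (g y) = p x" "f (j y) = (f ^^ n x) (p x)"
          by (auto simp: y j_def g_def rotate_cycles_def simp flip: True)
        then show ?thesis using p(4)[OF y(2)] r(2) by (simp add: X.commute)
      next
        case False
        then have "j (g y) = f (j y)" using y by (simp add: j_def g_def rotate_cycles_def)
        moreover have "f (j y) \<in> mspace X" using fX j \<open>y \<in> Y\<close> by blast
        ultimately show ?thesis using e by simp
      qed
    qed
    also have "\<dots> < ennreal \<eta>" using \<open>\<eta> > 0\<close> by (simp add: e_def ennreal_lessI)
    finally show "GH0_dist X f ?Y g < ennreal \<eta>" .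
    show "Per ?Y g = mspace ?Y"
    proof -
      have "\<exists>m\<ge>1. (g ^^ m) y = y" if "y \<in> Y" for y
      proof -
        obtain x t where y: "y = (x, t)" "x \<in> K" "t < n x" using \<open>y \<in> Y\<close> by (auto simp: Y_def)
        then have "(g ^^ n x) y = y" by (simp add: g_def rotate_cycles_funpow)
        then show ?thesis using p(2)[OF y(2)] by blast
      qed
      then show ?thesis by (auto simp: Per_def Y)
    qed
  qed
qed

section \<open>Transfer of periodic points to \<open>X\<close>\<close>

lemma semiconj_funpow:
  assumes "\<And>y. y \<in> S \<Longrightarrow> f (h y) = h (g y)" "g \<in> S \<rightarrow> S" "y \<in> S"
  shows "(f ^^ n) (h y) = h ((g ^^ n) y)"
proof -
  have "(g ^^ n) y \<in> S \<and> (f ^^ n) (h y) = h ((g ^^ n) y)"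
    using assms by (induction n) auto
  then show ?thesis ..
qed

theorem theorem1p2:
  fixes X :: "'a metric" and f :: "'a \<Rightarrow> 'a" and \<mu> :: "'a measure"
  assumes "compact_space (mtopology_of X)"
    and "homeomorphic_map (mtopology_of X) (mtopology_of X) f"
    and "top_GH_stable X f"
    and "borel_prob_on X \<mu>"
    and "invariant_measure f \<mu>"
    and "supp_measure X \<mu> = mspace X"
  shows "mtopology_of X closure_of Per X f = mspace X"
proof -
  interpret X: Metric_space "mspace X" "mdist X" by simp
  have fc: "continuous_map (mtopology_of X) (mtopology_of X) f"
    using assms(2) homeomorphic_imp_continuous_map by blast
  then have fX: "f \<in> mspace X \<rightarrow> mspace X" by (auto simp: continuous_map_def)
  have "\<exists>p\<in>Per X f. p \<in> X.mball x \<epsilon>" if x: "x \<in> mspace X" and "\<epsilon> > 0" for x \<epsilon>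
  proof -
    \<comment> \<open>Stability is defined with targets over \<open>real\<close>, whereas the
      approximating systems live on pairs in \<open>'a \<times> nat\<close>.\<close>
    obtain \<eta> where "\<eta> > 0" and \<eta>: "\<And>(Y :: ('a \<times> nat) metric) g. GH_shadowed \<epsilon> \<eta> X f Y g"
      using top_GH_stable_any_type[OF assms(3) fX] \<open>\<epsilon> > 0\<close> by blast
    obtain Y :: "('a \<times> nat) metric" and g where Y: "compact_space (mtopology_of Y)"
        and g: "homeomorphic_map (mtopology_of Y) (mtopology_of Y) g"
        and d: "GH0_dist X f Y g < ennreal \<eta>" and per: "Per Y g = mspace Y"
      using periodic_approximation[OF assms(1) fc assms(4-6) \<open>\<eta> > 0\<close>] .
    obtain h where h: "GH_isometry \<epsilon> Y X h" "\<And>y. y \<in> mspace Y \<Longrightarrow> f (h y) = h (g y)"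
      using \<eta>[of Y g] Y g d unfolding GH_shadowed_def by blast
    obtain y where y: "y \<in> mspace Y" "mdist X (h y) x < \<epsilon>"
      using GH_isometry_dense[OF h(1) x] .
    have gY: "g \<in> mspace Y \<rightarrow> mspace Y"
      using homeomorphic_imp_surjective_map[OF g] by auto
    obtain m where m: "m \<ge> 1" "(g ^^ m) y = y" using per y(1) by (auto simp: Per_def)
    \<comment> \<open>The semiconjugacy \<open>h\<close> carries a cycle of \<open>g\<close> to a
      periodic orbit of \<open>f\<close>.\<close>
    have "(f ^^ m) (h y) = h y" using semiconj_funpow[of "mspace Y" f h g, OF h(2) gY y(1), of m] m(2) by simp
    moreover have "h y \<in> mspace X" using h(1) y(1) by (auto simp: GH_isometry_def)
    ultimately show ?thesis
      using m(1) x y(2) by (intro bexI[of _ "h y"]) (auto simp: Per_def X.commute)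
  qed
  then show ?thesis
    unfolding mtopology_of_def X.metric_closure_of by auto
qed

end
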